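(* Let $N\in\mathbb{N}$ be fixed and let $\mathcal{F}=\{c_1,\dots,c_m\}$ be a nonempty collection of $k$-colourings of $K_N$. Set $\mathcal{P}=\mathrm{Forb}(\mathcal{F})$ and suppose $\mathcal{P}_n\ne\emptyset$ for every $n\in\mathbb{N}$. For every $\varepsilon$ with $0<\varepsilon<1$, there exist constants $n_0\in\mathbb{N}$ and $C_0>0$ such that for any $k$-colouring template $t$ for $K_n$ with $n\ge n_0$ and $\mathrm{Ent}(t)>(\pi(\mathcal{P})+\varepsilon)\binom{n}{2}$, there are at least $C_0\varepsilon\binom{n}{N}$ pairs $(A,c_i)$ with $A\subseteq[n]$, $|A|=N$, and $c_i\in\mathcal{F}$ such that $c_i\le t_{|A}$.
   Context: $k\ge2$ is a fixed integer and $[k]=\{1,\dots,k\}$. $K_n$ is the complete graph on vertex set $[n]$. A $k$-colouring of $K_n$ is a function $c:E(K_n)\to[k]$. For $A=\{a_1<\dots<a_m\}\subseteq[n]$ the restriction $c_{|A}$ is the $k$-colouring of $K_m$ given by $c_{|A}(ij)=c(a_ia_j)$. A ($k$-colouring) template for $K_n$ is a function $t$ assigning to each edge $e$ a nonempty set $t(e)\subseteq[k]$; its restriction $t_{|A}$ is the template for $K_m$ with $t_{|A}(ij)=t(a_ia_j)$. $\langle t\rangle$ is the set of realisations of $t$, i.e. $k$-colourings $c$ of $K_n$ with $c(e)\in t(e)$ for all $e$. The entropy is $\mathrm{Ent}(t)=\sum_{e\in E(K_n)}\log_k|t(e)|$. For a $k$-colouring $c$ of $K_N$ and an $N$-set $A$,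 $c\le t_{|A}$ means $c(e)\in t_{|A}(e)$ for every $e\in E(K_N)$. $\mathrm{Forb}(\mathcal{F})=(\mathrm{Forb}(\mathcal{F})_n)_n$, where $\mathrm{Forb}(\mathcal{F})_n$ is the set of $k$-colourings $c$ of $K_n$ with $c_{|A}\notin\mathcal{F}$ for every $N$-set $A\subseteq[n]$. For $\mathcal{P}$ closed under restrictions with all $\mathcal{P}_n$ nonempty, $\mathrm{ex}(n,\mathcal{P})=\max\{\mathrm{Ent}(t): t\text{ a template for }K_n,\ \langle t\rangle\subseteq\mathcal{P}_n\}$ and the entropy density is $\pi(\mathcal{P})=\lim_{n\to\infty}\mathrm{ex}(n,\mathcal{P})/\binom n2$ (the limit exists). *)

theory Defs
  imports Complex_Main "HOL-Library.FuncSet" "HOL-Library.Ramsey"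
begin

text \<open>
  The edges of the complete graph on \<open>{1..n}\<close> are its two-element subsets. Colourings and templates
  are extensional functions (equal to \<open>undefined\<close> off the edge set), so that equality of HOL
  functions is equality of colourings and the sets below are finite.
\<close>

type_synonym edge = "nat set"
type_synonym colouring = "edge \<Rightarrow> nat"
type_synonym template = "edge \<Rightarrow> nat set"

definition edges :: "nat \<Rightarrow> edge set" where
  "edges n = nsets {1..n} 2"

definition colourings :: "nat \<Rightarrow> nat \<Rightarrow> colouring set" where
  "colourings k n = edges n \<rightarrow>\<^sub>E {1..k}"

definition templates :: "nat \<Rightarrow> nat \<Rightarrow> template set" where
  "templates k n = edges n \<rightarrow>\<^sub>E {S. S \<subseteq> {1..k} \<and> S \<noteq> {}}"

text \<open>
  For \<open>A = {a\<^sub>1 < \<dots> < a\<^sub>m}\<close> and \<open>1 \<le> i \<le> m\<close>, \<open>nth_least A i = a\<^sub>i\<close>; the shift by one is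
  there because list positions start at 0.
\<close>

definition nth_least :: "nat set \<Rightarrow> nat \<Rightarrow> nat" where
  "nth_least A i = sorted_list_of_set A ! (i - 1)"

text \<open>The restriction, for both colourings and templates, to a finite vertex set.\<close>

definition restriction :: "(edge \<Rightarrow> 'a) \<Rightarrow> nat set \<Rightarrow> edge \<Rightarrow> 'a" where
  "restriction f A = (\<lambda>e\<in>edges (card A). f (nth_least A ` e))"

definition conforms :: "nat \<Rightarrow> colouring \<Rightarrow> template \<Rightarrow> bool" where
  "conforms n c t \<longleftrightarrow> (\<forall>e\<in>edges n. c e \<in> t e)"

definition realisations :: "nat \<Rightarrow> nat \<Rightarrow> template \<Rightarrow> colouring set" where
  "realisations k n t = {c \<in> colourings k n. conforms n c t}"

definition Ent :: "nat \<Rightarrow> nat \<Rightarrow> template \<Rightarrow> real" where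
  "Ent k n t = (\<Sum>e\<in>edges n. log (real k) (real (card (t e))))"

definition Forb :: "nat \<Rightarrow> nat \<Rightarrow> colouring set \<Rightarrow> nat \<Rightarrow> colouring set" where
  "Forb k N F n = {c \<in> colourings k n. \<forall>A\<in>nsets {1..n} N. restriction c A \<notin> F}"

text \<open>
  The next two notions are meant for properties \<open>P\<close> that are closed under restriction and have all
  \<open>P n\<close> nonempty: then the maximum is over a finite nonempty set, and the limit exists.
\<close>

definition ex_entropy :: "nat \<Rightarrow> nat \<Rightarrow> (nat \<Rightarrow> colouring set) \<Rightarrow> real" where
  "ex_entropy k n P = Max (Ent k n ` {t \<in> templates k n. realisations k n t \<subseteq> P n})"

definition entropy_density :: "nat \<Rightarrow> (nat \<Rightarrow> colouring set) \<Rightarrow> real" where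
  "entropy_density k P = lim (\<lambda>n. ex_entropy k n P / real (n choose 2))"

end

theory Submission
  imports Defs
begin

text \<open>
  Averaging over \<open>n\<close>-sets shows that \<open>ex(n, P) / binom(n, 2)\<close> is nonincreasing, so for some \<open>m\<close> it
  is below \<open>\<pi>(P) + \<epsilon>/2\<close>. The average of \<open>Ent(t\<^sub>B) / binom(m, 2)\<close> over the \<open>m\<close>-sets \<open>B\<close> exceeds
  \<open>\<pi>(P) + \<epsilon>\<close>, and no term exceeds 1, so a proportion at least \<open>\<epsilon>/2\<close> of the \<open>m\<close>-sets carries
  entropy above \<open>ex(m, P)\<close>. Each of these contains an \<open>N\<close>-set \<open>A\<close> and some \<open>c \<in> F\<close> with
  \<open>c \<le> t\<^sub>A\<close>, and an \<open>N\<close>-set lies in \<open>binom(n - N, m - N)\<close> of the \<open>m\<close>-sets.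
\<close>

section \<open>Double counting over subsets\<close>

text \<open>Removing \<open>T\<close> is a bijection onto the \<open>(m - card T)\<close>-subsets of
  \<open>S - T\<close>, with inverse adding \<open>T\<close>. The bound
  \<open>card T \<le> m\<close> guards the truncated subtraction: beyond it the left side is 0 and
  the right side 1.\<close>

lemma card_supersets_nsets:
  assumes "finite S" "T \<subseteq> S" "card T \<le> m"
  shows "card {B \<in> nsets S m. T \<subseteq> B} = (card S - card T) choose (m - card T)"
proof -
  have fT: "finite T" using assms finite_subset by blast
  have "bij_betw (\<lambda>B. B - T) {B \<in> nsets S m. T \<subseteq> B} (nsets (S - T) (m - card T))"
  proof (rule bij_betw_byWitness[where f' = "\<lambda>D. D \<union> T"])
    show "(\<lambda>B. B - T) ` {B \<in> nsets S m. T \<subseteq> B} \<subseteq> nsets (S - T) (m - card T)"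
      using fT by (auto simp: nsets_def card_Diff_subset)
    show "(\<lambda>D. D \<union> T) ` nsets (S - T) (m - card T) \<subseteq> {B \<in> nsets S m. T \<subseteq> B}"
    proof clarify
      fix D assume D: "D \<in> nsets (S - T) (m - card T)"
      then have "D \<inter> T = {}" "finite D" "card D = m - card T" by (auto simp: nsets_def)
      then have "card (D \<union> T) = m" using fT assms(3) by (simp add: card_Un_disjoint)
      with D assms(2) fT show "D \<union> T \<in> nsets S m \<and> T \<subseteq> D \<union> T"
        by (auto simp: nsets_def)
    qed
  qed (auto simp: nsets_def)
  then have "card {B \<in> nsets S m. T \<subseteq> B} = card (nsets (S - T) (m - card T))"
    by (rule bij_betw_same_card)
  also have "\<dots> = (card S - card T) choose (m - card T)"
    using assms fT by (simp add: card_nsets card_Diff_subset)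
  finally show ?thesis .
qed

text \<open>Swap the two sums: each \<open>r\<close>-set is counted once for every
  \<open>m\<close>-set containing it. The case \<open>r = 2\<close> serves for entropies,
  \<open>r = N\<close> for conforming pairs.\<close>

lemma sum_nsets_nsets:
  fixes f :: "'a set \<Rightarrow> real"
  assumes "finite S" "r \<le> m"
  shows "(\<Sum>B\<in>nsets S m. \<Sum>A\<in>nsets B r. f A)
    = real ((card S - r) choose (m - r)) * (\<Sum>A\<in>nsets S r. f A)"
proof -
  have "(\<Sum>B\<in>nsets S m. \<Sum>A\<in>nsets B r. f A)
      = (\<Sum>B\<in>nsets S m. \<Sum>A\<in>{A \<in> nsets S r. A \<subseteq> B}. f A)"
    by (intro sum.cong refl) (auto simp: nsets_def)
  also have "\<dots> = (\<Sum>A\<in>nsets S r. \<Sum>B\<in>{B \<in> nsets S m. A \<subseteq> B}. f A)"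
    using assms(1) by (intro sum.swap_restrict finite_imp_finite_nsets)
  also have "\<dots> = (\<Sum>A\<in>nsets S r. real ((card S - r) choose (m - r)) * f A)"
  proof (rule sum.cong[OF refl])
    fix A assume "A \<in> nsets S r"
    then have "A \<subseteq> S" "card A = r" by (auto simp: nsets_def)
    then show "(\<Sum>B\<in>{B \<in> nsets S m. A \<subseteq> B}. f A) = real ((card S - r) choose (m - r)) * f A"
      using card_supersets_nsets[OF assms(1), of A m] assms(2) by simp
  qed
  finally show ?thesis by (simp add: sum_distrib_left)
qed

section \<open>Restrictions\<close>

lemma strict_mono_on_nth_least:
  assumes "finite A"
  shows "strict_mono_on {1..card A} (nth_least A)"
proof (rule strict_mono_onI)
  fix i j assume "i \<in> {1..card A}" "j \<in> {1..card A}" "i < j"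
  then have "i - 1 < j - 1" "j - 1 < length (sorted_list_of_set A)" by auto
  then show "nth_least A i < nth_least A j"
    unfolding nth_least_def
    using sorted_wrt_nth_less[OF strict_sorted_list_of_set] by blast
qed

lemma bij_betw_nth_least:
  assumes "finite A"
  shows "bij_betw (nth_least A) {1..card A} A"
proof -
  have "bij_betw (\<lambda>i. i - 1) {1..card A} {..<card A}"
    by (rule bij_betw_byWitness[where f' = Suc]) auto
  moreover have "bij_betw ((!) (sorted_list_of_set A)) {..<card A} A"
    using assms by (intro bij_betw_nth) auto
  ultimately have "bij_betw ((!) (sorted_list_of_set A) \<circ> (\<lambda>i. i - 1)) {1..card A} A"
    by (rule bij_betw_trans)
  then show ?thesis
    by (simp add: nth_least_def[abs_def] comp_def)
qed

lemma bij_betw_edges: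
  assumes "finite B"
  shows "bij_betw ((`) (nth_least B)) (edges (card B)) (nsets B 2)"
  unfolding edges_def using bij_betw_nth_least[OF assms] by (rule bij_betw_nsets)

text \<open>Since \<open>nth_least B\<close> is increasing, mapping it over the sorted list of
  \<open>A\<close> yields a strictly sorted list, which must be the sorted list of the
  image.\<close>

lemma nth_least_image:
  assumes "finite B" "A \<subseteq> {1..card B}" "i \<in> {1..card A}"
  shows "nth_least (nth_least B ` A) i = nth_least B (nth_least A i)"
proof -
  have fA: "finite A" using assms(2) finite_subset by blast
  have sm: "strict_mono_on A (nth_least B)"
    using strict_mono_on_nth_least[OF assms(1)] assms(2)
    by (meson monotone_on_subset)
  have "sorted_wrt (<) (map (nth_least B) (sorted_list_of_set A))"
    unfolding sorted_wrt_map
    by (rule sorted_wrt_mono_rel[OF _ strict_sorted_list_of_set])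
      (use sm fA in \<open>auto simp: strict_mono_on_def\<close>)
  then have "sorted_list_of_set (set (map (nth_least B) (sorted_list_of_set A)))
      = map (nth_least B) (sorted_list_of_set A)"
    by (intro sorted_list_of_set.idem_if_sorted_distinct) (simp_all only: strict_sorted_iff)
  then show ?thesis
    using assms(3) fA by (auto simp: nth_least_def)
qed

lemma finite_edges [simp]: "finite (edges n)"
  by (simp add: edges_def finite_imp_finite_nsets)

lemma card_edges [simp]: "card (edges n) = n choose 2"
  by (simp add: edges_def)

text \<open>The order-preserving relabellings compose, by \<open>nth_least_image\<close>. Hence an
  \<open>N\<close>-set inside a restricted template can be treated as an \<open>N\<close>-subset of
  the original vertices.\<close>

lemma restriction_restriction:
  assumes "finite B" "A \<subseteq> {1..card B}"
  shows "restriction (restriction f B) A = restriction f (nth_least B ` A)"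
proof -
  have fA: "finite A" using assms(2) finite_subset by blast
  have cA: "card (nth_least B ` A) = card A"
    using bij_betw_nth_least[OF assms(1)] assms(2)
    by (meson bij_betw_imp_inj_on card_image inj_on_subset)
  show ?thesis
  proof (rule ext)
    fix e
    show "restriction (restriction f B) A e = restriction f (nth_least B ` A) e"
    proof (cases "e \<in> edges (card A)")
      case True
      then have e: "e \<subseteq> {1..card A}" by (auto simp: edges_def nsets_def)
      have "nth_least A ` e \<in> nsets A 2"
        using bij_betw_edges[OF fA] True by (rule bij_betwE[THEN bspec])
      then have "nth_least A ` e \<in> edges (card B)"
        using assms(2) nsets_mono unfolding edges_def by blast
      moreover have "nth_least B ` nth_least A ` e = nth_least (nth_least B ` A) ` e"
        unfolding image_image
        by (rule image_cong) (use nth_least_image[OF assms] e in auto)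
      ultimately show ?thesis using True cA by (simp add: restriction_def)
    qed (simp add: restriction_def cA)
  qed
qed

lemma restriction_in_templates:
  assumes "t \<in> templates k n" "B \<subseteq> {1..n}"
  shows "restriction t B \<in> templates k (card B)"
proof -
  have fB: "finite B" using assms(2) finite_subset by blast
  have "nth_least B ` e \<in> edges n" if "e \<in> edges (card B)" for e
    using bij_betwE[OF bij_betw_edges[OF fB]] that nsets_mono[OF assms(2), of 2]
    unfolding edges_def by blast
  then show ?thesis
    using assms(1) unfolding templates_def restriction_def by (fastforce simp: PiE_iff)
qed

section \<open>Entropy\<close>

text \<open>Undoing the relabelling turns the entropy into a sum over edges of the original graph,
  the form that double counting requires.\<close>

lemma Ent_restriction:
  assumes "finite B"
  shows "Ent k (card B) (restriction t B) = (\<Sum>e\<in>nsets B 2. log (real k) (real (card (t e))))"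
proof -
  have "Ent k (card B) (restriction t B)
      = (\<Sum>e\<in>edges (card B). log (real k) (real (card (t (nth_least B ` e)))))"
    unfolding Ent_def by (intro sum.cong) (auto simp: restriction_def)
  also have "\<dots> = (\<Sum>e\<in>nsets B 2. log (real k) (real (card (t e))))"
    by (rule sum.reindex_bij_betw[OF bij_betw_edges[OF assms]])
  finally show ?thesis .
qed

lemma sum_Ent_restriction:
  assumes "2 \<le> m"
  shows "(\<Sum>B\<in>nsets {1..n} m. Ent k m (restriction t B)) = real ((n - 2) choose (m - 2)) * Ent k n t"
proof -
  have "(\<Sum>B\<in>nsets {1..n} m. Ent k m (restriction t B))
      = (\<Sum>B\<in>nsets {1..n} m. \<Sum>e\<in>nsets B 2. log (real k) (real (card (t e))))"
    by (intro sum.cong refl) (auto simp: nsets_def Ent_restriction)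
  also have "\<dots> = real ((n - 2) choose (m - 2)) * Ent k n t"
    by (subst sum_nsets_nsets) (use assms in \<open>auto simp: Ent_def edges_def\<close>)
  finally show ?thesis .
qed

lemma template_card:
  assumes "t \<in> templates k n" "e \<in> edges n"
  shows "1 \<le> card (t e)" "card (t e) \<le> k"
proof -
  have e: "t e \<subseteq> {1..k}" "t e \<noteq> {}" using assms by (auto simp: templates_def PiE_iff)
  then have "finite (t e)" using finite_subset by blast
  with e show "1 \<le> card (t e)" by (simp add: Suc_leI card_gt_0_iff)
  show "card (t e) \<le> k" using card_mono[OF _ e(1)] by simp
qed

lemma Ent_nonneg:
  assumes "2 \<le> k" "t \<in> templates k n"
  shows "0 \<le> Ent k n t"
  unfolding Ent_def
proof (rule sum_nonneg)
  fix e assume "e \<in> edges n"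
  then show "0 \<le> log (real k) (real (card (t e)))"
    using template_card(1)[OF assms(2), of e] assms(1) by simp
qed

lemma Ent_le:
  assumes "2 \<le> k" "t \<in> templates k n"
  shows "Ent k n t \<le> real (n choose 2)"
proof -
  have "log (real k) (real (card (t e))) \<le> 1" if "e \<in> edges n" for e
    using template_card[OF assms(2) that] assms(1) by simp
  from sum_mono[of "edges n", OF this] show ?thesis by (simp add: Ent_def)
qed

lemma finite_templates: "finite (templates k n)"
  unfolding templates_def by (rule finite_PiE) auto

section \<open>Realisations and forbidden colourings\<close>

text \<open>A template constrains each edge independently, so \<open>c\<close> can be copied onto
  \<open>A\<close> and the remaining edges filled with arbitrary permitted colours.\<close>

lemma colouring_extends:
  assumes t: "t \<in> templates k n" and A: "A \<in> nsets {1..n} N"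
    and c: "c \<in> colourings k N" and conf: "conforms N c (restriction t A)"
  shows "\<exists>d\<in>realisations k n t. restriction d A = c"
proof -
  have A': "finite A" "card A = N" "A \<subseteq> {1..n}" using A by (auto simp: nsets_def)
  have bij: "bij_betw ((`) (nth_least A)) (edges N) (nsets A 2)"
    using bij_betw_edges[OF A'(1)] A'(2) by simp
  have sub: "nsets A 2 \<subseteq> edges n" unfolding edges_def by (rule nsets_mono[OF A'(3)])
  let ?g = "the_inv_into (edges N) ((`) (nth_least A))"
  \<comment> \<open>\<open>?g\<close> pulls an edge inside \<open>A\<close> back to an edge of the
    \<open>N\<close>-vertex graph. The choice outside \<open>A\<close> is sound because template
    values are nonempty.\<close>
  define d where "d = (\<lambda>e\<in>edges n. if e \<in> nsets A 2 then c (?g e) else SOME x. x \<in> t e)"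
  have dt: "d e \<in> t e" if e: "e \<in> edges n" for e
  proof (cases "e \<in> nsets A 2")
    case True
    then have "e \<in> (`) (nth_least A) ` edges N" using bij by (simp add: bij_betw_def)
    then obtain e' where e': "e = nth_least A ` e'" "e' \<in> edges N" by (rule imageE)
    then have "?g e = e'" using bij by (simp add: bij_betw_def the_inv_into_f_f)
    then show ?thesis
      using conf e' True e A'(2) by (auto simp: d_def conforms_def restriction_def)
  next
    case False
    have "t e \<noteq> {}" using t e by (auto simp: templates_def PiE_iff)
    then have "(SOME x. x \<in> t e) \<in> t e" by (simp add: some_in_eq)
    then show ?thesis using False e by (simp add: d_def)
  qed
  have "d \<in> colourings k n"
    using dt t by (fastforce simp: colourings_def templates_def PiE_iff d_def)
  then have "d \<in> realisations k n t" using dt by (simp add: realisations_def conforms_def)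
  moreover have "restriction d A = c"
  proof (rule ext)
    fix e
    show "restriction d A e = c e"
    proof (cases "e \<in> edges N")
      case True
      then have "nth_least A ` e \<in> nsets A 2" using bij by (rule bij_betwE[THEN bspec, rotated])
      moreover have "?g (nth_least A ` e) = e"
        using bij True by (simp add: bij_betw_def the_inv_into_f_f)
      ultimately show ?thesis using True sub A'(2) by (auto simp: restriction_def d_def)
    next
      case False
      \<comment> \<open>Off the edge set both sides are \<open>undefined\<close>.\<close>
      then show ?thesis
        using c A'(2) by (auto simp: restriction_def colourings_def PiE_iff extensional_def)
    qed
  qed
  ultimately show ?thesis by blast
qed

text \<open>This replaces realisations by the pairs to be counted. A conforming \<open>c\<close>
  extends to a realisation that contains it; conversely, restricting a realisation gives a colouring
  conforming to the restricted template.\<close>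

lemma realisations_subset_Forb_iff:
  assumes F: "F \<subseteq> colourings k N" and t: "t \<in> templates k n"
  shows "realisations k n t \<subseteq> Forb k N F n
    \<longleftrightarrow> (\<forall>A\<in>nsets {1..n} N. \<forall>c\<in>F. \<not> conforms N c (restriction t A))"
proof (intro iffI ballI notI subsetI)
  fix A c
  assume sub: "realisations k n t \<subseteq> Forb k N F n" and A: "A \<in> nsets {1..n} N"
    and c: "c \<in> F" and "conforms N c (restriction t A)"
  then obtain d where "d \<in> realisations k n t" "restriction d A = c"
    using colouring_extends[OF t A] F by blast
  then show False using sub A c by (auto simp: Forb_def)
next
  fix d
  assume no: "\<forall>A\<in>nsets {1..n} N. \<forall>c\<in>F. \<not> conforms N c (restriction t A)"
    and d: "d \<in> realisations k n t"
  have "restriction d A \<notin> F" if A: "A \<in> nsets {1..n} N" for A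
  proof -
    have A': "finite A" "card A = N" "A \<subseteq> {1..n}" using A by (auto simp: nsets_def)
    have "nth_least A ` e \<in> edges n" if "e \<in> edges N" for e
      using bij_betwE[OF bij_betw_edges[OF A'(1)]] that nsets_mono[OF A'(3), of 2] A'(2)
      unfolding edges_def by blast
    then have "conforms N (restriction d A) (restriction t A)"
      using d A'(2) by (auto simp: conforms_def restriction_def realisations_def)
    then show ?thesis using no A by blast
  qed
  then show "d \<in> Forb k N F n" using d by (auto simp: Forb_def realisations_def)
qed

text \<open>The previous criterion for the template on \<open>B\<close>, moved back to the original
  vertices: \<open>nth_least B\<close> carries the \<open>N\<close>-subsets of \<open>{1..m}\<close>
  onto those of \<open>B\<close>.\<close>

lemma restriction_realisations_subset_Forb_iff:
  assumes F: "F \<subseteq> colourings k N" and t: "t \<in> templates k n" and B: "B \<in> nsets {1..n} m"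
  shows "realisations k m (restriction t B) \<subseteq> Forb k N F m
    \<longleftrightarrow> (\<forall>A\<in>nsets B N. \<forall>c\<in>F. \<not> conforms N c (restriction t A))"
proof -
  have B': "finite B" "card B = m" "B \<subseteq> {1..n}" using B by (auto simp: nsets_def)
  have img: "nsets B N = (\<lambda>A. nth_least B ` A) ` nsets {1..m} N"
    using bij_betw_nsets[OF bij_betw_nth_least[OF B'(1)], of N] B'(2) by (simp add: bij_betw_def)
  have "restriction (restriction t B) A = restriction t (nth_least B ` A)"
    if "A \<in> nsets {1..m} N" for A
    using that B' by (intro restriction_restriction) (auto simp: nsets_def)
  then show ?thesis
    using realisations_subset_Forb_iff[OF F restriction_in_templates[OF t B'(3)]] B'(2)
    by (simp add: img)
qed

section \<open>The extremal entropy and its density\<close>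

lemma Ent_le_ex_entropy:
  assumes "t \<in> templates k n" "realisations k n t \<subseteq> P n"
  shows "Ent k n t \<le> ex_entropy k n P"
  unfolding ex_entropy_def by (rule Max_ge) (use assms finite_templates in auto)

text \<open>The maximum runs over a nonempty finite set: the template of singletons
  \<open>{c e}\<close> has \<open>c\<close> as its only realisation.\<close>

lemma ex_entropy_attained:
  assumes "c \<in> P n" "P n \<subseteq> colourings k n"
  obtains t where "t \<in> templates k n" "realisations k n t \<subseteq> P n" "ex_entropy k n P = Ent k n t"
proof -
  define s where "s = (\<lambda>e\<in>edges n. {c e})"
  have c: "c \<in> colourings k n" using assms by blast
  have "s \<in> templates k n"
    using c by (auto simp: s_def templates_def colourings_def PiE_iff)
  moreover have "d = c" if "d \<in> realisations k n s" for d
  proof (rule PiE_ext)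
    show "d \<in> edges n \<rightarrow>\<^sub>E {1..k}" "c \<in> edges n \<rightarrow>\<^sub>E {1..k}"
      using that c by (simp_all add: realisations_def colourings_def)
    show "d e = c e" if "e \<in> edges n" for e
      using \<open>d \<in> realisations k n s\<close> that by (simp add: realisations_def conforms_def s_def)
  qed
  ultimately have "s \<in> {t \<in> templates k n. realisations k n t \<subseteq> P n}"
    using assms(1) by blast
  then have "ex_entropy k n P \<in> Ent k n ` {t \<in> templates k n. realisations k n t \<subseteq> P n}"
    unfolding ex_entropy_def by (intro Max_in) (use finite_templates in auto)
  then show thesis using that by blast
qed

lemma ex_entropy_nonneg:
  assumes "2 \<le> k" "Forb k N F n \<noteq> {}"
  shows "0 \<le> ex_entropy k n (Forb k N F)"
proof -
  obtain c where "c \<in> Forb k N F n" using assms(2) by blast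
  moreover have "Forb k N F n \<subseteq> colourings k n" by (auto simp: Forb_def)
  ultimately obtain t where "t \<in> templates k n" "ex_entropy k n (Forb k N F) = Ent k n t"
    by (rule ex_entropy_attained)
  then show ?thesis using Ent_nonneg[OF assms(1)] by simp
qed

text \<open>Every restriction of an optimal template on \<open>Suc n\<close> vertices to an
  \<open>n\<close>-set is admissible, so its entropy is at most the extremal value for
  \<open>n\<close>. Averaging over all \<open>n\<close>-sets gives the inequality.\<close>

lemma ex_entropy_ratio_Suc:
  assumes F: "F \<subseteq> colourings k N" and ne: "Forb k N F (Suc n) \<noteq> {}" and n: "2 \<le> n"
  shows "ex_entropy k (Suc n) (Forb k N F) / real (Suc n choose 2)
    \<le> ex_entropy k n (Forb k N F) / real (n choose 2)"
proof -
  let ?x = "\<lambda>n. ex_entropy k n (Forb k N F)"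
  obtain c where "c \<in> Forb k N F (Suc n)" using ne by blast
  moreover have "Forb k N F (Suc n) \<subseteq> colourings k (Suc n)" by (auto simp: Forb_def)
  ultimately obtain t where t: "t \<in> templates k (Suc n)"
    and tF: "realisations k (Suc n) t \<subseteq> Forb k N F (Suc n)" and x: "?x (Suc n) = Ent k (Suc n) t"
    by (rule ex_entropy_attained)
  have "Ent k n (restriction t B) \<le> ?x n" if B: "B \<in> nsets {1..Suc n} n" for B
  proof (rule Ent_le_ex_entropy)
    have B': "card B = n" "B \<subseteq> {1..Suc n}" using B by (auto simp: nsets_def)
    show "restriction t B \<in> templates k n" using restriction_in_templates[OF t B'(2)] B'(1) by simp
    have "nsets B N \<subseteq> nsets {1..Suc n} N" by (rule nsets_mono[OF B'(2)])
    then show "realisations k n (restriction t B) \<subseteq> Forb k N F n"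
      using tF unfolding restriction_realisations_subset_Forb_iff[OF F t B]
        realisations_subset_Forb_iff[OF F t] by blast
  qed
  then have "(\<Sum>B\<in>nsets {1..Suc n} n. Ent k n (restriction t B))
      \<le> (\<Sum>B\<in>nsets {1..Suc n} n. ?x n)"
    by (rule sum_mono)
  \<comment> \<open>An \<open>n\<close>-set omits one vertex, and an edge survives unless that
    vertex is one of its two ends.\<close>
  moreover have "Suc n - 2 choose (n - 2) = n - 1"
    using n binomial_symmetric[of "n - 2" "Suc n - 2"] by (simp add: Suc_diff_le)
  ultimately have le: "real (n - 1) * ?x (Suc n) \<le> real (Suc n) * ?x n"
    by (simp only: sum_Ent_restriction[OF n] x[symmetric]) simp
  \<comment> \<open>Both ratios are written with the common factor \<open>2 / (P * Q * R)\<close>;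
    scaling \<open>le\<close> by it gives the claim.\<close>
  define P Q R where "P = real (n - 1)" and "Q = real n" and "R = real (Suc n)"
  have pos: "0 < P" "0 < Q" "0 < R" using n by (simp_all add: P_def Q_def R_def)
  have "real (Suc n choose 2) = R * Q / 2"
    unfolding R_def Q_def by (simp add: choose_two real_of_nat_div) (simp add: algebra_simps)
  moreover have "real (n choose 2) = Q * P / 2"
    unfolding P_def Q_def using n by (simp add: choose_two real_of_nat_div)
  moreover have "a / (R * Q / 2) = P * a * (2 / (P * Q * R))"
    "a / (Q * P / 2) = R * a * (2 / (P * Q * R))" for a
    using pos by (simp_all add: field_simps)
  moreover have "P * ?x (Suc n) * (2 / (P * Q * R)) \<le> R * ?x n * (2 / (P * Q * R))"
    using le pos by (intro mult_right_mono) (simp_all add: P_def R_def)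
  ultimately show ?thesis by (simp only:)
qed

text \<open>The ratios are eventually nonincreasing and bounded below by 0, so the
  \<open>lim\<close> in the definition is a genuine limit.\<close>

lemma entropy_density_tendsto:
  assumes k: "2 \<le> k" and F: "F \<subseteq> colourings k N" and ne: "\<And>n. Forb k N F n \<noteq> {}"
  shows "(\<lambda>n. ex_entropy k n (Forb k N F) / real (n choose 2))
    \<longlonglongrightarrow> entropy_density k (Forb k N F)"
proof -
  let ?r = "\<lambda>n. ex_entropy k n (Forb k N F) / real (n choose 2)"
  \<comment> \<open>The shift by 2 skips the indices where \<open>n choose 2\<close> is 0 and the
    quotient takes the default value 0.\<close>
  have "decseq (\<lambda>n. ?r (n + 2))"
    by (rule decseq_SucI) (use ex_entropy_ratio_Suc[OF F ne, of "_ + 2"] in simp)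
  moreover have "0 \<le> ?r (n + 2)" for n
    using ex_entropy_nonneg[OF k ne] by (intro divide_nonneg_nonneg) auto
  ultimately obtain L where "(\<lambda>n. ?r (n + 2)) \<longlonglongrightarrow> L"
    using decseq_convergent by blast
  then have "?r \<longlonglongrightarrow> L" by (rule LIMSEQ_offset)
  then show ?thesis unfolding entropy_density_def by (simp add: limI)
qed

section \<open>Supersaturation\<close>

theorem lemma2p11:
  fixes k N :: nat and F :: "colouring set" and \<epsilon> :: real
  assumes "k \<ge> 2"
    and "F \<subseteq> colourings k N" and "F \<noteq> {}"
    and "\<And>n. Forb k N F n \<noteq> {}"
    and "0 < \<epsilon>" and "\<epsilon> < 1"
  shows "\<exists>(n\<^sub>0::nat) (C\<^sub>0::real). C\<^sub>0 > 0 \<and>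
    (\<forall>n\<ge>n\<^sub>0. \<forall>t\<in>templates k n.
      Ent k n t > (entropy_density k (Forb k N F) + \<epsilon>) * real (n choose 2) \<longrightarrow>
      real (card {(A, c). A \<in> nsets {1..n} N \<and> c \<in> F \<and> conforms N c (restriction t A)})
        \<ge> C\<^sub>0 * \<epsilon> * real (n choose N))"
proof -
  define p where "p = entropy_density k (Forb k N F)"
  define r where "r = (\<lambda>n. ex_entropy k n (Forb k N F) / real (n choose 2))"
  have lim: "r \<longlonglongrightarrow> p"
    unfolding r_def p_def by (rule entropy_density_tendsto) fact+
  have "0 \<le> r n" for n
    using ex_entropy_nonneg[OF assms(1,4)] by (simp add: r_def)
  then have p0: "0 \<le> p" using lim by (intro LIMSEQ_le_const) auto
  \<comment> \<open>This \<open>m\<close> depends on neither \<open>n\<close> nor \<open>t\<close>,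
    so it can serve as \<open>n\<^sub>0\<close> and determine \<open>C\<^sub>0\<close>. The lower
    bounds on it allow double counting of both edges and \<open>N\<close>-sets.\<close>
  have "\<forall>\<^sub>F m in sequentially. r m < p + \<epsilon> / 2 \<and> m \<ge> max 2 N"
    by (rule eventually_conj[OF order_tendstoD(2)[OF lim] eventually_ge_at_top])
      (use assms(5) in simp)
  then obtain m where m: "r m < p + \<epsilon> / 2" "2 \<le> m" "N \<le> m"
    using eventually_happens by fastforce
  have m2: "0 < m choose 2" and mN: "0 < m choose N" using m by simp_all
  have exm: "ex_entropy k m (Forb k N F) \<le> real (m choose 2) * (p + \<epsilon> / 2)"
    using m(1) m2 by (simp add: r_def divide_simps mult_ac)
  have finF: "finite F"
    by (rule finite_subset[OF assms(2)]) (simp add: colourings_def finite_PiE)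
  have "1 / (2 * real (m choose N)) * \<epsilon> * real (n choose N)
      \<le> real (card {(A, c). A \<in> nsets {1..n} N \<and> c \<in> F \<and> conforms N c (restriction t A)})"
    if n: "m \<le> n" and t: "t \<in> templates k n" and big: "(p + \<epsilon>) * real (n choose 2) < Ent k n t"
    for n t
  proof -
    define f where "f = (\<lambda>A. real (card {c \<in> F. conforms N c (restriction t A)}))"
    define T where "T = (\<Sum>A\<in>nsets {1..n} N. f A)"
    have "{(A, c). A \<in> nsets {1..n} N \<and> c \<in> F \<and> conforms N c (restriction t A)}
        = Sigma (nsets {1..n} N) (\<lambda>A. {c \<in> F. conforms N c (restriction t A)})"
      by auto
    then have T: "real (card {(A, c). A \<in> nsets {1..n} N \<and> c \<in> F \<and> conforms N c (restriction t A)}) = T"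
      using finF by (simp add: T_def f_def finite_imp_finite_nsets)
    \<comment> \<open>One bound covers both kinds of \<open>B\<close>. Without a conforming pair,
      the extremal value for \<open>m\<close> applies; with one, the sum is at least 1 and the
      trivial bound \<open>m choose 2\<close> suffices, as \<open>p\<close> is nonnegative. Summing
      over \<open>B\<close> then brings in the number \<open>T\<close> of pairs directly.\<close>
    have "Ent k m (restriction t B) \<le> real (m choose 2) * (p + \<epsilon> / 2 + (\<Sum>A\<in>nsets B N. f A))"
      if B: "B \<in> nsets {1..n} m" for B
    proof -
      have B': "finite B" "card B = m" "B \<subseteq> {1..n}" using B by (auto simp: nsets_def)
      have tB: "restriction t B \<in> templates k m"
        using restriction_in_templates[OF t B'(3)] B'(2) by simp
      have f0: "0 \<le> f A" for A by (simp add: f_def)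
      show ?thesis
      proof (cases "realisations k m (restriction t B) \<subseteq> Forb k N F m")
        case True
        have "Ent k m (restriction t B) \<le> real (m choose 2) * (p + \<epsilon> / 2)"
          using Ent_le_ex_entropy[of _ _ _ "Forb k N F", OF tB True] exm by simp
        also have "\<dots> \<le> real (m choose 2) * (p + \<epsilon> / 2 + (\<Sum>A\<in>nsets B N. f A))"
          by (intro mult_left_mono) (auto intro: sum_nonneg f0)
        finally show ?thesis .
      next
        case False
        then obtain A c where A: "A \<in> nsets B N" and c: "c \<in> F" "conforms N c (restriction t A)"
          unfolding restriction_realisations_subset_Forb_iff[OF assms(2) t B] by blast
        have "{c \<in> F. conforms N c (restriction t A)} \<noteq> {}" using c by blast
        then have "1 \<le> f A" using finF by (simp add: f_def Suc_leI card_gt_0_iff)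
        also have "f A \<le> (\<Sum>A\<in>nsets B N. f A)"
          using A B'(1) f0 by (intro member_le_sum finite_imp_finite_nsets) auto
        finally have "1 \<le> p + \<epsilon> / 2 + (\<Sum>A\<in>nsets B N. f A)" using p0 assms(5) by simp
        then have "real (m choose 2) * 1 \<le> real (m choose 2) * (p + \<epsilon> / 2 + (\<Sum>A\<in>nsets B N. f A))"
          by (intro mult_left_mono) auto
        then show ?thesis using Ent_le[OF assms(1) tB] by simp
      qed
    qed
    then have "(\<Sum>B\<in>nsets {1..n} m. Ent k m (restriction t B))
        \<le> (\<Sum>B\<in>nsets {1..n} m. real (m choose 2) * (p + \<epsilon> / 2 + (\<Sum>A\<in>nsets B N. f A)))"
      by (rule sum_mono)
    also have "\<dots> = real (m choose 2) *
        (real (n choose m) * (p + \<epsilon> / 2) + real ((n - N) choose (m - N)) * T)"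
      using m(3) by (simp add: sum_distrib_left[symmetric] sum.distrib sum_nsets_nsets T_def)
    finally have le: "real ((n - 2) choose (m - 2)) * Ent k n t \<le> \<dots>"
      by (simp only: sum_Ent_restriction[OF m(2)])
    have pos2: "0 < (n - 2) choose (m - 2)" and posN: "0 < (n - N) choose (m - N)"
      using n by simp_all
    \<comment> \<open>Both sides count the pairs of an \<open>m\<close>-set and a 2-subset of it;
      \<open>eqN\<close> does the same for \<open>N\<close>-subsets.\<close>
    have eq2: "real (n choose m) * real (m choose 2) = real (n choose 2) * real ((n - 2) choose (m - 2))"
      using choose_mult[OF m(2) n] by (metis of_nat_mult)
    have eqN: "real (n choose m) * real (m choose N) = real (n choose N) * real ((n - N) choose (m - N))"
      using choose_mult[OF m(3) n] by (metis of_nat_mult)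
    have "real (m choose 2) * (real (n choose m) * (p + \<epsilon>))
        = real ((n - 2) choose (m - 2)) * ((p + \<epsilon>) * real (n choose 2))"
      using eq2 by (simp add: mult_ac)
    also have "\<dots> \<le> real ((n - 2) choose (m - 2)) * Ent k n t"
      using big by (intro mult_left_mono) auto
    also note le
    \<comment> \<open>The factor \<open>m choose 2\<close> cancels. The gap between
      \<open>p + \<epsilon>\<close> and \<open>p + \<epsilon> / 2\<close> has to be made up by the
      term with \<open>T\<close>.\<close>
    finally have "real (n choose m) * (p + \<epsilon>)
        \<le> real (n choose m) * (p + \<epsilon> / 2) + real ((n - N) choose (m - N)) * T"
      using m2 by (simp only: mult_le_cancel_left_pos of_nat_0_less_iff)
    then have "real (n choose m) * \<epsilon> \<le> 2 * (real ((n - N) choose (m - N)) * T)"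
      by (simp add: algebra_simps)
    then have "real (m choose N) * (real (n choose m) * \<epsilon>)
        \<le> real (m choose N) * (2 * (real ((n - N) choose (m - N)) * T))"
      by (rule mult_left_mono) simp
    then have "real ((n - N) choose (m - N)) * (\<epsilon> * real (n choose N))
        \<le> real ((n - N) choose (m - N)) * (2 * real (m choose N) * T)"
      using eqN by (simp add: mult_ac)
    then have "\<epsilon> * real (n choose N) \<le> 2 * real (m choose N) * T"
      using posN by (simp only: mult_le_cancel_left_pos of_nat_0_less_iff)
    then show ?thesis using mN T by (simp add: divide_simps mult_ac)
  qed
  then show ?thesis
    using mN unfolding p_def
    by (intro exI[of _ m] exI[of _ "1 / (2 * real (m choose N))"]) auto
qed

end
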